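(* Let $(x^v,\mu^v)$ be a solution to the relaxed master problem (RMP), let $d^v\in\mathcal D$ be the distribution it induces (i.e. $x^v\in\mathcal X_{d^v}$), and suppose that $x^v\notin\mathcal K_{sd^v}$ for some $s\in\mathcal S_{d^v}$. Let $\rho^v$ be an optimal solution to the dual of the linear program $$\Psi(x^v,\xi_{sd^v}):=\min_{y\in\mathbb R^{n_2}_+,\;w^+,w^-\in\mathbb R^{m_2}_+}\{\mathbf 1^\top w^++\mathbf 1^\top w^-:\;W_{sd^v}y+w^+-w^-=h_{sd^v}-T_{sd^v}x^v\}.$$ Then $x=x^v$ violates the inequality $$(\rho^v)^\top(h_{sd^v}-T_{sd^v}x)\le U_{d^vs}\,(1-\mathbb 1_{d^v}(x)).$$
   Context: Setting: $\mathcal X\subseteq\mathbb R^{n_1}$, $c\in\mathbb R^{n_1}$, $\mathcal D$ is a finite set, $(\mathcal X_d)_{d\in\mathcal D}$ is a partition of $\mathcal X$, and $\mathbb 1_d:\mathcal X\to\{0,1\}$ is the characteristic function of $\mathcal X_d$. For $x\in\mathcal X$, the unique $d$ with $x\in\mathcal X_d$ is the (index of the) distribution induced (enforced) by $x$. Discrete distributions: for each $d\in\mathcal D$ the random data has a discrete distribution $\mathsf P_d$ with a finite set of scenarios $\mathcal S_d$; scenario $s\in\mathcal S_d$ has realization $\xi_{sd}=(q_{sd},W_{sd},T_{sd},h_{sd})$, with $q_{sd}\in\mathbb R^{n_2}$, $W_{sd}\in\mathbb R^{m_2\times n_2}$, $T_{sd}\in\mathbb R^{m_2\times n_1}$, $h_{sd}\in\mathbb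 R^{m_2}$, and probability $\pi_{sd}>0$, $\sum_{s\in\mathcal S_d}\pi_{sd}=1$. The second-stage problem is $Q(x,\xi)=\min_{y\ge0}\{q^\top y: Wy=h-Tx\}$. $\mathcal K_{sd}=\{x\in\mathbb R^{n_1}:\exists y\ge 0,\ W_{sd}y=h_{sd}-T_{sd}x\}$ and $\mathbf 1=(1,\dots,1)^\top\in\mathbb R^{m_2}$. Assumption: for all $d\in\mathcal D$, $s\in\mathcal S_d$ there is a constant $U_{ds}<\infty$ with $$U_{ds}\ge\max_{x\in\mathcal X}\ \min_{y\in\mathbb R^{n_2}_+,\,w^+,w^-\in\mathbb R^{m_2}_+}\{\mathbf 1^\top w^++\mathbf 1^\top w^-: W_{sd}y+w^+-w^-=h_{sd}-T_{sd}x\}.$$ The dual of $\Psi(x,\xi_{sd})$ is $\max\{\rho^\top(h_{sd}-T_{sd}x):\rho^\top W_{sd}\le0,\ -\mathbf 1\le\rho\le\mathbf 1\}$. (RMP): given finite sets $\underline{\mathcal F_d},\underline{\mathcal O_d}$ of real-valued functions on $\mathcal X$ ($d\in\mathcal D$), minimize $c^\top x+\mu$ over $x\in\mathcal X$, $\mu\in\mathbb R$ subject to, for every $d\in\mathcal D$: if $x\in\mathcal X_d$ then $f(x)\le0$ for all $f\in\underline{\mathcal F_d}$ and $o(x)\le\mu$ for all $o\in\underline{\mathcal O_d}$. A "solution" to (RMP) is a feasible point. *)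

theory Defs
  imports "HOL-Analysis.Analysis"
begin

text \<open>
  Orders between vectors are the componentwise ones of \<^typ>\<open>real ^ 'n\<close>, and
  \<^term>\<open>1 :: real ^ 'n\<close> is the all-ones vector.
\<close>

text \<open>A realization \<open>(q, W, T, h)\<close> of the second-stage data.\<close>

record ('n1, 'n2, 'm2) realization =
  cost_vec   :: "real ^ ('n2::finite)"
  recourse   :: "real ^ ('n2::finite) ^ ('m2::finite)"
  technology :: "real ^ ('n1::finite) ^ ('m2::finite)"
  rhs        :: "real ^ ('m2::finite)"

definition stage2_rhs ::
    "real ^ 'n1 \<Rightarrow> ('n1::finite, 'n2::finite, 'm2::finite) realization \<Rightarrow> real ^ 'm2" where
  "stage2_rhs x \<xi> = rhs \<xi> - technology \<xi> *v x"

text \<open>The first-stage points for which the second stage is feasible, the set \<open>K\<close>.\<close>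

definition stage2_feasible ::
    "('n1::finite, 'n2::finite, 'm2::finite) realization \<Rightarrow> (real ^ 'n1) set" where
  "stage2_feasible \<xi> = {x. \<exists>y. 0 \<le> y \<and> recourse \<xi> *v y = stage2_rhs x \<xi>}"

text \<open>
  The infimum below is attained, since the linear program is always feasible and its
  objective is bounded below by 0; it is taken in \<^typ>\<open>ereal\<close> so that the supremum over
  all first-stage points is meaningful even when it is infinite.
\<close>

definition Psi ::
    "real ^ 'n1 \<Rightarrow> ('n1::finite, 'n2::finite, 'm2::finite) realization \<Rightarrow> ereal" where
  "Psi x \<xi> =
    (INF (y, wp, wm) \<in> {(y, wp, wm). 0 \<le> y \<and> 0 \<le> wp \<and> 0 \<le> wm \<and>
                                   recourse \<xi> *v y + wp - wm = stage2_rhs x \<xi>}.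
       ereal (1 \<bullet> wp + 1 \<bullet> wm))"

definition dual_feasible ::
    "('n1::finite, 'n2::finite, 'm2::finite) realization \<Rightarrow> real ^ 'm2 \<Rightarrow> bool" where
  "dual_feasible \<xi> \<rho> \<longleftrightarrow> \<rho> v* recourse \<xi> \<le> 0 \<and> - 1 \<le> \<rho> \<and> \<rho> \<le> 1"

definition dual_optimal ::
    "real ^ 'n1 \<Rightarrow> ('n1::finite, 'n2::finite, 'm2::finite) realization \<Rightarrow> real ^ 'm2 \<Rightarrow> bool" where
  "dual_optimal x \<xi> \<rho> \<longleftrightarrow> is_arg_max (\<lambda>r. r \<bullet> stage2_rhs x \<xi>) (dual_feasible \<xi>) \<rho>"

text \<open>
  Feasibility in the relaxed master problem: \<open>Fs d\<close> and \<open>Os d\<close> are the feasibility and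
  optimality constraint functions attached to \<open>d\<close>. Only their values on \<open>X\<close> matter.
\<close>

definition rmp_feasible ::
    "(real ^ 'n1) set \<Rightarrow> 'd set \<Rightarrow> ('d \<Rightarrow> (real ^ 'n1) set) \<Rightarrow>
     ('d \<Rightarrow> (real ^ 'n1 \<Rightarrow> real) set) \<Rightarrow> ('d \<Rightarrow> (real ^ 'n1 \<Rightarrow> real) set) \<Rightarrow>
     real ^ ('n1::finite) \<Rightarrow> real \<Rightarrow> bool" where
  "rmp_feasible X D Xd Fs Os x \<mu> \<longleftrightarrow>
     x \<in> X \<and>
     (\<forall>d\<in>D. x \<in> Xd d \<longrightarrow> (\<forall>f\<in>Fs d. f x \<le> 0) \<and> (\<forall>g\<in>Os d. g x \<le> \<mu>))"

end

theory Submission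
  imports Defs
begin

text \<open>
  At \<open>x\<^sup>v\<close> the indicator of its own cell equals 1, so the right-hand side of the inequality
  is 0, and the claim is that the optimal dual value is strictly positive. As the dual
  feasible set is the intersection of a cone with a box around the origin, it is enough to
  find some \<open>r\<close> with \<open>r\<^sup>T W \<le> 0\<close> and \<open>r\<^sup>T (h - T x\<^sup>v) > 0\<close>: scaling \<open>r\<close> into the
  box keeps both conditions. Such an \<open>r\<close> is a certificate of the infeasibility of
  \<open>W y = h - T x\<^sup>v, y \<ge> 0\<close>, and it exists by Farkas' lemma
  (\<open>farkas_finitely_generated\<close>, \<open>farkas_matrix\<close>), which in turn comes from separating
  \<open>h - T x\<^sup>v\<close> from the cone generated by the columns of \<open>W\<close>. That cone is closed because it
  has finitely many generators.
\<close>

text \<open>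
  A hyperplane separating \<open>z\<close> strictly from the closed cone can be moved to the origin:
  a linear functional that is bounded below on a cone is nonnegative on it, since a negative
  value could be scaled below any bound.
\<close>

lemma farkas_finitely_generated:
  fixes z :: "'a::euclidean_space"
  assumes "finite S" and "z \<notin> convex_cone hull S"
  obtains r where "r \<bullet> z > 0" and "\<And>v. v \<in> S \<Longrightarrow> r \<bullet> v \<le> 0"
proof -
  obtain a \<beta> where az: "a \<bullet> z < \<beta>" and a\<beta>: "\<And>v. v \<in> convex_cone hull S \<Longrightarrow> a \<bullet> v > \<beta>"
    using separating_hyperplane_closed_point[OF convex_convex_cone_hull
        closed_convex_cone_hull[OF assms(1)] assms(2)] by blast
  have "\<beta> < 0"
    using a\<beta>[OF convex_cone_hull_contains_0] by simp
  have "a \<bullet> v \<ge> 0" if "v \<in> S" for v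
  proof (rule ccontr)
    assume "\<not> a \<bullet> v \<ge> 0"
    then have neg: "a \<bullet> v < 0" by simp
    then have "0 \<le> \<beta> / (a \<bullet> v)"
      using \<open>\<beta> < 0\<close> by (simp add: divide_nonpos_nonpos)
    \<comment> \<open>The multiple of \<open>v\<close> that lies exactly on the separating hyperplane.\<close>
    then have "(\<beta> / (a \<bullet> v)) *\<^sub>R v \<in> convex_cone hull S"
      using that by (simp add: convex_cone_hull_mul hull_inc)
    from a\<beta>[OF this] show False
      using neg by simp
  qed
  then show thesis
    using that[of "- a"] az \<open>\<beta> < 0\<close> by simp
qed

text \<open>
  The vectors \<open>W y\<close> with \<open>y \<ge> 0\<close> form a convex cone containing the columns of \<open>W\<close>, hence
  also the cone that they generate. A right-hand side that no such \<open>y\<close> attains therefore lies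
  outside the generated cone, and the certificate only has to be tested on the columns.
\<close>

lemma farkas_matrix:
  fixes W :: "real ^ 'n::finite ^ 'm::finite"
  assumes "\<nexists>y. 0 \<le> y \<and> W *v y = b"
  obtains r where "r v* W \<le> 0" and "r \<bullet> b > 0"
proof -
  let ?K = "(*v) W ` {y. 0 \<le> y}"
  have "convex_cone {y :: real ^ 'n. 0 \<le> y}"
    by (auto simp: convex_cone_iff less_eq_vec_def)
  then have "convex_cone ?K"
    by (simp add: convex_cone_linear_image)
  moreover have "range (\<lambda>j. column j W) \<subseteq> ?K"
  proof
    fix v assume "v \<in> range (\<lambda>j. column j W)"
    then obtain j where "v = W *v axis j 1"
      by (auto simp: matrix_vector_mult_basis)
    moreover have "0 \<le> (axis j 1 :: real ^ 'n)"
      by (simp add: less_eq_vec_def axis_def)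
    ultimately show "v \<in> ?K" by blast
  qed
  ultimately have "convex_cone hull range (\<lambda>j. column j W) \<subseteq> ?K"
    by (simp add: hull_minimal)
  then have "b \<notin> convex_cone hull range (\<lambda>j. column j W)"
    using assms by blast
  then obtain r where "r \<bullet> b > 0" and r: "\<And>j. r \<bullet> column j W \<le> 0"
    by (meson farkas_finitely_generated finite_imageI finite rangeI)
  have "(r v* W) $ j \<le> 0" for j
  proof -
    have "(r v* W) $ j = (r v* W) \<bullet> axis j 1"
      by (simp add: inner_axis)
    also have "\<dots> = r \<bullet> column j W"
      by (simp add: dot_lmul_matrix matrix_vector_mult_basis)
    finally show ?thesis using r by simp
  qed
  then have "r v* W \<le> 0"
    by (simp add: less_eq_vec_def)
  then show thesis
    using \<open>r \<bullet> b > 0\<close> by (rule that)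
qed

text \<open>
  Each entry of a vector is at most its Euclidean norm, so the normalized Farkas certificate
  satisfies the bounds that the dual of \<open>\<Psi>\<close> imposes.
\<close>

lemma dual_feasible_positive_if_infeasible:
  assumes "x \<notin> stage2_feasible \<xi>"
  obtains r where "dual_feasible \<xi> r" and "r \<bullet> stage2_rhs x \<xi> > 0"
proof -
  obtain r where rW: "r v* recourse \<xi> \<le> 0" and rb: "r \<bullet> stage2_rhs x \<xi> > 0"
    using assms farkas_matrix[of "recourse \<xi>" "stage2_rhs x \<xi>"]
    unfolding stage2_feasible_def by blast
  have pos: "norm r > 0"
    using rb by auto
  let ?u = "r /\<^sub>R norm r"
  have "?u v* recourse \<xi> = (r v* recourse \<xi>) /\<^sub>R norm r"
    by (simp add: scaleR_vector_matrix_assoc)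
  then have "?u v* recourse \<xi> \<le> 0"
    using rW pos by (simp add: less_eq_vec_def divide_nonpos_pos mult_nonneg_nonpos)
  moreover have "\<bar>?u $ i\<bar> \<le> 1" for i
    using component_le_norm_cart[of ?u i] pos by simp
  then have "- 1 \<le> ?u \<and> ?u \<le> 1"
    unfolding less_eq_vec_def by (simp add: abs_le_iff)
  ultimately have "dual_feasible \<xi> ?u"
    by (simp add: dual_feasible_def)
  moreover have "?u \<bullet> stage2_rhs x \<xi> > 0"
    using rb pos by simp
  ultimately show thesis by (rule that)
qed

lemma dual_optimal_value_positive:
  assumes "x \<notin> stage2_feasible \<xi>" and "dual_optimal x \<xi> \<rho>"
  shows "\<rho> \<bullet> stage2_rhs x \<xi> > 0"
proof -
  obtain r where "dual_feasible \<xi> r" and "r \<bullet> stage2_rhs x \<xi> > 0"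
    using dual_feasible_positive_if_infeasible[OF assms(1)] .
  then show ?thesis
    using assms(2) by (auto simp: dual_optimal_def is_arg_max_linorder intro: less_le_trans)
qed

theorem theorem1:
  fixes X :: "(real ^ 'n1::finite) set"
    and D :: "'d set"
    and Xd :: "'d \<Rightarrow> (real ^ 'n1) set"
    and S :: "'d \<Rightarrow> 's set"
    and \<xi> :: "'s \<Rightarrow> 'd \<Rightarrow> ('n1, 'n2::finite, 'm2::finite) realization"
    and \<pi> :: "'s \<Rightarrow> 'd \<Rightarrow> real"
    and U :: "'d \<Rightarrow> 's \<Rightarrow> real"
    and Fs Os :: "'d \<Rightarrow> (real ^ 'n1 \<Rightarrow> real) set"
    and xv :: "real ^ 'n1" and \<mu>v :: real and dv :: 'd and s :: 's
    and \<rho>v :: "real ^ 'm2"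
  assumes "finite D"
    and "disjoint_family_on Xd D" and "(\<Union>d\<in>D. Xd d) = X"
    and "\<And>d. d \<in> D \<Longrightarrow> finite (S d)"
    and "\<And>d s. d \<in> D \<Longrightarrow> s \<in> S d \<Longrightarrow> \<pi> s d > 0"
    and "\<And>d. d \<in> D \<Longrightarrow> (\<Sum>s\<in>S d. \<pi> s d) = 1"
    and "\<And>d s. d \<in> D \<Longrightarrow> s \<in> S d \<Longrightarrow> ereal (U d s) \<ge> (SUP x\<in>X. Psi x (\<xi> s d))"
    and "\<And>d. d \<in> D \<Longrightarrow> finite (Fs d)" and "\<And>d. d \<in> D \<Longrightarrow> finite (Os d)"
    and "rmp_feasible X D Xd Fs Os xv \<mu>v"
    and "dv \<in> D" and "xv \<in> Xd dv"
    and "s \<in> S dv" and "xv \<notin> stage2_feasible (\<xi> s dv)"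
    and "dual_optimal xv (\<xi> s dv) \<rho>v"
  shows "\<not> (\<rho>v \<bullet> (rhs (\<xi> s dv) - technology (\<xi> s dv) *v xv)
             \<le> U dv s * (1 - indicator (Xd dv) xv))"
proof -
  have "\<rho>v \<bullet> stage2_rhs xv (\<xi> s dv) > 0"
    using dual_optimal_value_positive assms(14,15) .
  then show ?thesis
    using \<open>xv \<in> Xd dv\<close> by (simp add: stage2_rhs_def)
qed

end
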